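(* Let $\Gamma=(G,\sigma)$ be a connected signed graph, where $G$ is a finite simple graph with vertex set $V(G)$ and $\sigma:E(G)\to\{-1,+1\}$, and let $w:V(G)\to\mathbb{R}^+$ be a (positive) weight function. Define the matrices $W(\Gamma)$ and $D(G)$ indexed by $V(G)$ by $W(\Gamma)_{uv}=\sigma(uv)\sqrt{w(u)w(v)}$ if $uv\in E(G)$ and $0$ otherwise, and $D(G)$ diagonal with $D(G)_{vv}=\sum_{u\sim v} w(u)$. Let $Q(\Gamma)=D(G)+W(\Gamma)$. For each vertex $v$, let $c_b(v)$ be the maximum number of vertices of a balanced complete subgraph of $\Gamma$ containing $v$. Then \[\lambda_1(Q(\Gamma)) \leq 2\sum_{v\in V(G)} \left(1 -\frac{1}{c_b(v)}\right) w(v).\]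
   Context: A signed graph is balanced if every cycle has sign $+1$, where the sign of a cycle is the product of the signs of its edges. A balanced complete subgraph of $\Gamma$ is a set of pairwise adjacent vertices of $G$ such that the induced signed complete graph is balanced (a single vertex counts as a balanced complete subgraph of order 1). $\lambda_1(M)$ denotes the largest eigenvalue of a real symmetric matrix $M$. Connectedness of $\Gamma$ means connectedness of the underlying graph $G$. *)

theory Defs
  imports "HOL-Analysis.Analysis"
begin

text \<open>
  The vertex set is the universe of a finite type \<open>'v\<close>, an edge is a two-element set of vertices.
  The signature \<open>\<sigma>\<close> is a total function whose values outside the edge set are never used.
\<close>

definition simple_graph :: "'v set set \<Rightarrow> bool" where
  "simple_graph E \<longleftrightarrow> (\<forall>e\<in>E. card e = 2)"

definition graph_connected :: "'v set set \<Rightarrow> bool" where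
  "graph_connected E \<longleftrightarrow> (\<forall>u v. (u, v) \<in> {(x, y). {x, y} \<in> E}\<^sup>*)"

definition signed_graph :: "'v set set \<Rightarrow> ('v set \<Rightarrow> real) \<Rightarrow> bool" where
  "signed_graph E \<sigma> \<longleftrightarrow> simple_graph E \<and> \<sigma> ` E \<subseteq> {-1, 1}"

text \<open>A cycle is given by the list of its vertices; the last edge joins the last vertex to the first.\<close>

definition cycle_edge :: "'v list \<Rightarrow> nat \<Rightarrow> 'v set" where
  "cycle_edge vs i = {vs ! i, vs ! (Suc i mod length vs)}"

definition is_cycle :: "'v set set \<Rightarrow> 'v list \<Rightarrow> bool" where
  "is_cycle E vs \<longleftrightarrow>
     3 \<le> length vs \<and> distinct vs \<and> (\<forall>i<length vs. cycle_edge vs i \<in> E)"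

definition cycle_sign :: "('v set \<Rightarrow> real) \<Rightarrow> 'v list \<Rightarrow> real" where
  "cycle_sign \<sigma> vs = (\<Prod>i<length vs. \<sigma> (cycle_edge vs i))"

definition balanced :: "'v set set \<Rightarrow> ('v set \<Rightarrow> real) \<Rightarrow> bool" where
  "balanced E \<sigma> \<longleftrightarrow> (\<forall>vs. is_cycle E vs \<longrightarrow> cycle_sign \<sigma> vs = 1)"

definition induced_edges :: "'v set set \<Rightarrow> 'v set \<Rightarrow> 'v set set" where
  "induced_edges E S = {e \<in> E. e \<subseteq> S}"

definition balanced_complete :: "'v set set \<Rightarrow> ('v set \<Rightarrow> real) \<Rightarrow> 'v set \<Rightarrow> bool" where
  "balanced_complete E \<sigma> S \<longleftrightarrow>
     (\<forall>u\<in>S. \<forall>v\<in>S. u \<noteq> v \<longrightarrow> {u, v} \<in> E) \<and> balanced (induced_edges E S) \<sigma>"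

definition c_b :: "'v::finite set set \<Rightarrow> ('v set \<Rightarrow> real) \<Rightarrow> 'v \<Rightarrow> nat" where
  "c_b E \<sigma> v = Max {card S |S. v \<in> S \<and> balanced_complete E \<sigma> S}"

definition W_matrix :: "'v::finite set set \<Rightarrow> ('v set \<Rightarrow> real) \<Rightarrow> ('v \<Rightarrow> real) \<Rightarrow> real^'v^'v" where
  "W_matrix E \<sigma> w = (\<chi> u v. if {u, v} \<in> E then \<sigma> {u, v} * sqrt (w u * w v) else 0)"

definition D_matrix :: "'v::finite set set \<Rightarrow> ('v \<Rightarrow> real) \<Rightarrow> real^'v^'v" where
  "D_matrix E w = (\<chi> u v. if u = v then (\<Sum>x | {x, v} \<in> E. w x) else 0)"

definition Q_matrix :: "'v::finite set set \<Rightarrow> ('v set \<Rightarrow> real) \<Rightarrow> ('v \<Rightarrow> real) \<Rightarrow> real^'v^'v" where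
  "Q_matrix E \<sigma> w = D_matrix E w + W_matrix E \<sigma> w"

definition eigenvalues :: "real^'n^'n \<Rightarrow> real set" where
  "eigenvalues M = {k. \<exists>x. x \<noteq> 0 \<and> M *v x = k *\<^sub>R x}"

text \<open>Meant for symmetric \<open>M\<close>, where the set of real eigenvalues is finite and nonempty.\<close>

definition lambda1 :: "real^'n^'n \<Rightarrow> real" where
  "lambda1 M = Max (eigenvalues M)"

end

theory Submission
  imports Defs
begin

text \<open>
  Let \<open>x\<close> be an eigenvector for \<open>\<lambda>\<^sub>1(Q)\<close>, let \<open>z\<^sub>v = sqrt(w\<^sub>v) |x\<^sub>v|\<close>, and let \<open>P\<close> consist of the
  edges that are positive after switching at the vertices where \<open>x\<close> is negative; every clique of
  \<open>P\<close> is balanced. AM-GM on the non-adjacent pairs (including \<open>u = v\<close>) gives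
  \<open>x \<bullet> Qx \<le> (\<Sum> w\<^sub>v) |x|\<^sup>2 + 2 (\<Sum>\<^sub>P z\<^sub>u z\<^sub>v) - (\<Sum> z\<^sub>v)\<^sup>2\<close>.
  The edge-local form of the Motzkin-Straus inequality,
  \<open>\<Sum>\<^sub>P (c\<^sub>e / (c\<^sub>e - 1)) z\<^sub>u z\<^sub>v \<le> (\<Sum> z\<^sub>v)\<^sup>2\<close> with \<open>c\<^sub>e\<close> the largest size of a clique of \<open>P\<close>
  through the edge \<open>e\<close>, is used twice, for \<open>z\<^sub>v\<close> and for \<open>sqrt(p\<^sub>v) z\<^sub>v\<close> with \<open>p\<^sub>v = 1 - 2 / c\<^sub>b(v)\<close>.
  This bounds the last two terms by \<open>(\<Sum> sqrt(p\<^sub>v) z\<^sub>v)\<^sup>2 \<le> (\<Sum> p\<^sub>v w\<^sub>v) |x|\<^sup>2\<close>, and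
  \<open>1 + p\<^sub>v = 2 (1 - 1 / c\<^sub>b(v))\<close>.
\<close>

section \<open>Eigenvalues of real symmetric matrices\<close>

text \<open>First variation: \<open>k * (y \<bullet> y) - y \<bullet> (M *v y)\<close> is
  nonnegative and vanishes at \<open>x\<close>, so its linear term along the residual
  \<open>r\<close> must vanish; that term is a multiple of \<open>r \<bullet> r\<close>.\<close>

lemma Rayleigh_max_eigenvector:
  fixes M :: "real^'n^'n"
  assumes sym: "transpose M = M"
    and max: "\<And>y. y \<bullet> (M *v y) \<le> k * (y \<bullet> y)"
    and x: "x \<bullet> (M *v x) = k * (x \<bullet> x)"
  shows "M *v x = k *\<^sub>R x"
proof -
  define r where "r = M *v x - k *\<^sub>R x"
  define b where "b = k * (r \<bullet> r) - r \<bullet> (M *v r)"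
  have adj: "x \<bullet> (M *v r) = r \<bullet> (M *v x)"
    by (metis dot_lmul_matrix inner_commute sym transpose_matrix_vector)
  have rr: "r \<bullet> (M *v x) - k * (r \<bullet> x) = r \<bullet> r"
    by (simp add: r_def inner_diff_right)
  have quad: "2 * t * (r \<bullet> r) \<le> t\<^sup>2 * b" for t
  proof -
    have "(x + t *\<^sub>R r) \<bullet> (M *v (x + t *\<^sub>R r)) =
        x \<bullet> (M *v x) + 2 * t * (r \<bullet> (M *v x)) + t\<^sup>2 * (r \<bullet> (M *v r))"
      using adj by (simp add: matrix_vector_right_distrib matrix_vector_mult_scaleR inner_add_left
          inner_add_right power2_eq_square algebra_simps)
    moreover have "(x + t *\<^sub>R r) \<bullet> (x + t *\<^sub>R r) = x \<bullet> x + 2 * t * (r \<bullet> x) + t\<^sup>2 * (r \<bullet> r)"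
      by (simp add: inner_add_left inner_add_right power2_eq_square inner_commute algebra_simps)
    ultimately have "2 * t * (r \<bullet> (M *v x) - k * (r \<bullet> x)) \<le> t\<^sup>2 * b"
      using max[of "x + t *\<^sub>R r"] x by (simp add: b_def algebra_simps)
    then show ?thesis by (simp only: rr)
  qed
  have "r \<bullet> r \<le> 0"
  proof (rule ccontr)
    assume "\<not> r \<bullet> r \<le> 0"
    then have pos: "r \<bullet> r > 0" by linarith
    have b0: "b > 0" using quad[of 1] pos unfolding power_one mult_1 by linarith
    \<comment> \<open>The choice of \<open>t\<close> minimises
      \<open>t\<^sup>2 * b - 2 * t * (r \<bullet> r)\<close>.\<close>
    have "2 * (r \<bullet> r / b) * (r \<bullet> r) \<le> (r \<bullet> r / b)\<^sup>2 * b"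
      by (rule quad)
    also have "\<dots> = (r \<bullet> r / b) * (r \<bullet> r)"
      using b0 by (simp add: power2_eq_square)
    finally have "(r \<bullet> r / b) * (r \<bullet> r) \<le> 0" by linarith
    moreover have "(r \<bullet> r / b) * (r \<bullet> r) > 0"
      using pos b0 by (intro mult_pos_pos divide_pos_pos)
    ultimately show False by linarith
  qed
  then have "r = 0" by (metis inner_gt_zero_iff not_le)
  then show ?thesis by (simp add: r_def)
qed

text \<open>The quadratic form attains its maximum on the compact unit sphere, and by homogeneity a
  maximiser there maximises the Rayleigh quotient, hence is an eigenvector.\<close>

lemma symmetric_eigenvalues_nonempty:
  fixes M :: "real^'n^'n"
  assumes sym: "transpose M = M"
  shows "eigenvalues M \<noteq> {}"
proof -
  have "sphere (0 :: real^'n) 1 \<noteq> {}"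
    using norm_axis_1[of undefined] by (metis dist_0_norm empty_iff mem_sphere)
  moreover have "continuous_on (sphere 0 1) (\<lambda>y :: real^'n. y \<bullet> (M *v y))"
    by (intro continuous_intros linear_continuous_on_compose[OF _ matrix_vector_mul_linear])
  ultimately obtain x :: "real^'n" where x: "x \<in> sphere 0 1"
    and max: "\<And>y. y \<in> sphere 0 1 \<Longrightarrow> y \<bullet> (M *v y) \<le> x \<bullet> (M *v x)"
    using continuous_attains_sup[of "sphere (0::real^'n) 1" "\<lambda>y. y \<bullet> (M *v y)"] by auto
  define k where "k = x \<bullet> (M *v x)"
  have "y \<bullet> (M *v y) \<le> k * (y \<bullet> y)" for y
  proof (cases "y = 0")
    case False
    have "sgn y \<bullet> (M *v sgn y) \<le> k"
      unfolding k_def by (rule max) (simp add: False norm_sgn)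
    moreover have "sgn y \<bullet> (M *v sgn y) = y \<bullet> (M *v y) / (norm y)\<^sup>2"
      by (simp add: sgn_div_norm matrix_vector_mult_scaleR power2_eq_square divide_simps)
    ultimately show ?thesis
      using False by (simp add: field_simps power2_norm_eq_inner)
  qed simp
  moreover have "x \<bullet> (M *v x) = k * (x \<bullet> x)"
    using x by (simp add: k_def dot_square_norm)
  ultimately have "M *v x = k *\<^sub>R x"
    by (rule Rayleigh_max_eigenvector[OF sym])
  moreover have "x \<noteq> 0" using x by auto
  ultimately show ?thesis by (auto simp: eigenvalues_def)
qed

text \<open>Eigenvectors chosen one per eigenvalue are nonzero and pairwise orthogonal, hence
  independent, so there are only finitely many in finite dimension.\<close>

lemma symmetric_eigenvalues_finite:
  fixes M :: "real^'n^'n"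
  assumes sym: "transpose M = M"
  shows "finite (eigenvalues M)"
proof -
  have "\<forall>k\<in>eigenvalues M. \<exists>x. x \<noteq> 0 \<and> M *v x = k *\<^sub>R x"
    by (simp add: eigenvalues_def)
  then obtain e where e: "\<And>k. k \<in> eigenvalues M \<Longrightarrow> e k \<noteq> 0 \<and> M *v e k = k *\<^sub>R e k"
    unfolding bchoice_iff by blast
  have orth: "e k \<bullet> e l = 0" if "k \<in> eigenvalues M" "l \<in> eigenvalues M" "k \<noteq> l" for k l
  proof -
    have "(M *v e k) \<bullet> e l = e k \<bullet> (M *v e l)"
      by (metis dot_lmul_matrix sym transpose_matrix_vector)
    then have "k * (e k \<bullet> e l) = l * (e k \<bullet> e l)"
      using e that by simp
    then show ?thesis using that by simp
  qed
  have inj: "inj_on e (eigenvalues M)"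
    by (rule inj_onI) (metis e orth inner_eq_zero_iff)
  have "independent (e ` eigenvalues M)"
  proof (rule pairwise_orthogonal_independent)
    show "pairwise orthogonal (e ` eigenvalues M)"
      by (auto simp: pairwise_def orthogonal_def intro: orth)
    show "0 \<notin> e ` eigenvalues M"
      using e by force
  qed
  then show ?thesis
    using inj independent_imp_finite finite_image_iff by blast
qed

text \<open>Finiteness and nonemptiness make the \<open>Max\<close> in \<open>lambda1\<close> a
  genuine eigenvalue, which supplies an eigenvector to work with.\<close>

lemma lambda1_in_eigenvalues:
  fixes M :: "real^'n^'n"
  assumes "transpose M = M"
  shows "lambda1 M \<in> eigenvalues M"
  unfolding lambda1_def
  by (intro Max_in symmetric_eigenvalues_finite symmetric_eigenvalues_nonempty assms)

section \<open>Motzkin-Straus inequalities\<close>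

lemma quadratic_form_sum:
  fixes A :: "real^'n^'n"
  shows "z \<bullet> (A *v z) = (\<Sum>u\<in>UNIV. \<Sum>v\<in>UNIV. A $ u $ v * (z $ u * z $ v))"
  by (simp add: inner_vec_def matrix_vector_mult_def sum_distrib_left mult_ac)

lemma sum_off_diagonal:
  fixes z :: "'a \<Rightarrow> real"
  assumes "finite S"
  shows "(\<Sum>u\<in>S. \<Sum>v\<in>S. (if u = v then 0 else q) * (z u * z v)) =
    q * ((\<Sum>u\<in>S. z u)\<^sup>2 - (\<Sum>u\<in>S. (z u)\<^sup>2))"
proof -
  have "(\<Sum>u\<in>S. \<Sum>v\<in>S. (if u = v then 0 else q) * (z u * z v)) =
      (\<Sum>u\<in>S. \<Sum>v\<in>S. q * (z u * z v) - (if u = v then q * (z u * z v) else 0))"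
    by (intro sum.cong) auto
  also have "\<dots> = q * ((\<Sum>u\<in>S. z u)\<^sup>2 - (\<Sum>u\<in>S. (z u)\<^sup>2))"
    using assms by (simp add: sum_subtractf right_diff_distrib power2_eq_square
        sum_distrib_left sum_distrib_right mult_ac)
  finally show ?thesis .
qed

text \<open>
  On a set of indices where all off-diagonal entries are nonzero the bound is Cauchy-Schwarz.
  If two indices \<open>u \<noteq> v\<close> of the support have a vanishing entry, the form is affine along
  \<open>e\<^sub>u - e\<^sub>v\<close>, so mass can be shifted until one of the two leaves the support.
\<close>

lemma weighted_Motzkin_Straus:
  fixes A :: "real^'n^'n" and z :: "real^'n"
  assumes sym: "transpose A = A"
    and diag: "\<And>u. A $ u $ u = 0"
    and clique: "\<And>S u v. \<lbrakk>\<And>x y. x \<in> S \<Longrightarrow> y \<in> S \<Longrightarrow> x \<noteq> y \<Longrightarrow> A $ x $ y \<noteq> 0; u \<in> S; v \<in> S; u \<noteq> v\<rbrakk>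
      \<Longrightarrow> A $ u $ v \<le> real (card S) / (real (card S) - 1)"
    and nonneg: "\<And>v. z $ v \<ge> 0"
  shows "z \<bullet> (A *v z) \<le> (\<Sum>v\<in>UNIV. z $ v)\<^sup>2"
  using nonneg
proof (induction "card {v. z $ v \<noteq> 0}" arbitrary: z rule: less_induct)
  case less
  define S where "S = {v. z $ v \<noteq> 0}"
  have symA: "A $ x $ y = A $ y $ x" for x y
    by (metis sym transpose_def vec_lambda_beta)
  show ?case
  proof (cases "\<exists>u\<in>S. \<exists>v\<in>S. u \<noteq> v \<and> A $ u $ v = 0")
    case True
    then obtain a b where ab: "a \<in> S" "b \<in> S" "a \<noteq> b" "A $ a $ b = 0"
      by blast
    \<comment> \<open>The conditions on the pair are symmetric, so \<open>u\<close> can be the index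
      with the larger partial derivative of the form; moving mass from \<open>v\<close> to
      \<open>u\<close> then does not lower the form.\<close>
    obtain u v where uv: "u \<in> S" "v \<in> S" "u \<noteq> v" "A $ u $ v = 0"
      and le: "(A *v z) $ v \<le> (A *v z) $ u"
      using ab symA[of a b] linear[of "(A *v z) $ a" "(A *v z) $ b"] by metis
    \<comment> \<open>Adding \<open>d\<close> moves the whole entry at \<open>v\<close> onto
      \<open>u\<close>: the total is kept and the support shrinks.\<close>
    define d :: "real^'n" where "d = z $ v *\<^sub>R (axis u 1 - axis v 1)"
    have Aax: "A *v axis x 1 = column x A" for x
      by (simp add: matrix_vector_mult_basis)
    have "d \<bullet> (A *v d) = 0"
      using uv diag symA[of u v]
      by (simp add: d_def matrix_vector_mult_scaleR matrix_vector_mult_diff_distrib Aax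
          inner_diff_left inner_axis' column_def)
    moreover have "d \<bullet> (A *v z) = z $ v * ((A *v z) $ u - (A *v z) $ v)"
      by (simp add: d_def inner_diff_left inner_axis')
    moreover have "z \<bullet> (A *v d) = d \<bullet> (A *v z)"
      by (metis dot_lmul_matrix inner_commute sym transpose_matrix_vector)
    ultimately have "z \<bullet> (A *v z) \<le> (z + d) \<bullet> (A *v (z + d))"
      using le less.prems[of v]
      by (simp add: matrix_vector_right_distrib inner_add_left inner_add_right)
    also have "\<dots> \<le> (\<Sum>x\<in>UNIV. (z + d) $ x)\<^sup>2"
    proof (rule less.hyps)
      have zd: "(z + d) $ x = (if x = u then z $ u + z $ v else if x = v then 0 else z $ x)" for x
        using uv by (simp add: d_def axis_def)
      show "(z + d) $ x \<ge> 0" for x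
        unfolding zd using less.prems by simp
      have "{x. (z + d) $ x \<noteq> 0} \<subseteq> S - {v}"
        unfolding zd using uv by (auto simp: S_def split: if_splits)
      then have "{x. (z + d) $ x \<noteq> 0} \<subset> S" using uv by blast
      then show "card {x. (z + d) $ x \<noteq> 0} < card {x. z $ x \<noteq> 0}"
        unfolding S_def by (intro psubset_card_mono) auto
    qed
    also have "(\<Sum>x\<in>UNIV. (z + d) $ x) = (\<Sum>x\<in>UNIV. z $ x)"
      by (simp add: d_def axis_def sum.distrib sum_subtractf flip: sum_distrib_left)
    finally show ?thesis .
  next
    case False
    define k where "k = real (card S)"
    define Z where "Z = (\<Sum>v\<in>S. z $ v)"
    have ZU: "(\<Sum>v\<in>UNIV. z $ v) = Z"
      unfolding Z_def S_def by (rule sum.mono_neutral_right) auto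
    have form: "z \<bullet> (A *v z) = (\<Sum>u\<in>S. \<Sum>v\<in>S. A $ u $ v * (z $ u * z $ v))"
      unfolding quadratic_form_sum S_def
      by (rule sum.mono_neutral_cong_right) (auto intro!: sum.mono_neutral_right)
    show ?thesis
    proof (cases "card S \<le> 1")
      \<comment> \<open>The factor \<open>k / (k - 1)\<close> needs two indices; with fewer, only
        diagonal entries enter the form.\<close>
      case True
      then have "x = y" if "x \<in> S" "y \<in> S" for x y
        using that by (simp add: card_le_Suc0_iff_eq)
      then have "z \<bullet> (A *v z) = 0"
        unfolding form by (intro sum.neutral ballI) (metis diag mult_zero_left)
      then show ?thesis by simp
    next
      case False2: False
      then have k: "k > 1" by (simp add: k_def)
      have "z \<bullet> (A *v z) \<le> (\<Sum>u\<in>S. \<Sum>v\<in>S. (if u = v then 0 else k / (k - 1)) * (z $ u * z $ v))"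
        unfolding form
      proof (intro sum_mono mult_right_mono)
        fix u v assume "u \<in> S" "v \<in> S"
        then show "A $ u $ v \<le> (if u = v then 0 else k / (k - 1))"
          using diag clique[of S u v] False by (auto simp: k_def)
      qed (simp add: less.prems)
      also have "\<dots> = k / (k - 1) * (Z\<^sup>2 - (\<Sum>u\<in>S. (z $ u)\<^sup>2))"
        unfolding Z_def by (rule sum_off_diagonal) simp
      also have "\<dots> \<le> Z\<^sup>2"
      proof -
        have "Z\<^sup>2 \<le> k * (\<Sum>u\<in>S. (z $ u)\<^sup>2)"
          using Cauchy_Schwarz_ineq_sum[of "\<lambda>_. 1" "\<lambda>v. z $ v" S] by (simp add: Z_def k_def)
        \<comment> \<open>The constants match because
          \<open>k / (k - 1) * (1 - 1 / k) = 1\<close>.\<close>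
        then show ?thesis using k by (simp add: field_simps)
      qed
      finally show ?thesis by (simp add: ZU)
    qed
  qed
qed

definition clique :: "('v \<Rightarrow> 'v \<Rightarrow> bool) \<Rightarrow> 'v set \<Rightarrow> bool" where
  "clique R S \<longleftrightarrow> (\<forall>u\<in>S. \<forall>v\<in>S. u \<noteq> v \<longrightarrow> R u v)"

text \<open>Meaningful on edges: for distinct \<open>u\<close>, \<open>v\<close> with
  \<open>R u v\<close> false the set is empty, so sums over pairs test \<open>R u v\<close>
  first.\<close>

definition edge_clique_number :: "('v::finite \<Rightarrow> 'v \<Rightarrow> bool) \<Rightarrow> 'v \<Rightarrow> 'v \<Rightarrow> nat" where
  "edge_clique_number R u v = Max (card ` {S. u \<in> S \<and> v \<in> S \<and> clique R S})"

lemma edge_clique_number_ge: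
  "u \<in> S \<Longrightarrow> v \<in> S \<Longrightarrow> clique R S \<Longrightarrow> card S \<le> edge_clique_number R u v"
  unfolding edge_clique_number_def by (rule Max_ge) auto

lemma edge_clique_number_commute: "edge_clique_number R u v = edge_clique_number R v u"
  unfolding edge_clique_number_def by (simp add: conj_left_commute)

lemma edge_clique_number_attained:
  assumes "symp R" "R u v"
  obtains S where "u \<in> S" "v \<in> S" "clique R S" "card S = edge_clique_number R u v"
proof -
  have "{u, v} \<in> {S. u \<in> S \<and> v \<in> S \<and> clique R S}"
    using assms by (auto simp: clique_def symp_def)
  then have "edge_clique_number R u v \<in> card ` {S. u \<in> S \<and> v \<in> S \<and> clique R S}"
    unfolding edge_clique_number_def by (intro Max_in) auto
  then show ?thesis by (elim imageE) (metis that mem_Collect_eq)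
qed

lemma edge_clique_number_ge_2:
  assumes "symp R" "irreflp R" "R u v"
  shows "edge_clique_number R u v \<ge> 2"
proof -
  have "u \<noteq> v" using assms by (auto simp: irreflp_def)
  moreover have "clique R {u, v}"
    using assms by (auto simp: clique_def symp_def)
  ultimately show ?thesis
    using edge_clique_number_ge[of u "{u, v}" v R] by simp
qed

text \<open>The map \<open>c / (c - 1)\<close> decreases for \<open>c > 1\<close>, and a clique
  through an edge has at most the edge's clique number of vertices, so these coefficients meet the
  clique condition of \<open>weighted_Motzkin_Straus\<close>.\<close>

lemma edge_local_Motzkin_Straus:
  fixes R :: "'v::finite \<Rightarrow> 'v \<Rightarrow> bool" and z :: "'v \<Rightarrow> real"
  assumes R: "symp R" "irreflp R"
    and nonneg: "\<And>v. z v \<ge> 0"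
  defines "c \<equiv> \<lambda>u v. real (edge_clique_number R u v)"
  shows "(\<Sum>u\<in>UNIV. \<Sum>v\<in>UNIV. if R u v then c u v / (c u v - 1) * (z u * z v) else 0)
    \<le> (\<Sum>v\<in>UNIV. z v)\<^sup>2"
proof -
  define A :: "real^'v^'v" where "A = (\<chi> u v. if R u v then c u v / (c u v - 1) else 0)"
  have "(\<chi> v. z v) \<bullet> (A *v (\<chi> v. z v)) \<le> (\<Sum>v\<in>UNIV. (\<chi> v. z v) $ v)\<^sup>2"
  proof (rule weighted_Motzkin_Straus)
    show "transpose A = A"
      using R by (auto simp: A_def transpose_def vec_eq_iff c_def symp_def
          edge_clique_number_commute[of R])
    show "A $ u $ u = 0" for u
      using R by (simp add: A_def irreflp_def)
  next
    fix S u v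
    assume S: "\<And>x y. x \<in> S \<Longrightarrow> y \<in> S \<Longrightarrow> x \<noteq> y \<Longrightarrow> A $ x $ y \<noteq> 0"
      and uv: "u \<in> S" "v \<in> S" "u \<noteq> v"
    have "clique R S"
      using S by (fastforce simp: clique_def A_def split: if_splits)
    then have le: "real (card S) \<le> c u v" and "R u v"
      using uv edge_clique_number_ge by (auto simp: c_def clique_def)
    have "card S \<ge> 2"
      using card_mono[of S "{u, v}"] uv by simp
    then show "A $ u $ v \<le> real (card S) / (real (card S) - 1)"
      using le \<open>R u v\<close> by (simp add: A_def field_simps)
  qed (simp add: nonneg)
  then show ?thesis
    by (simp add: quadratic_form_sum A_def if_distrib[of "\<lambda>a. a * _"] cong: if_cong)
qed

text \<open>
  The edge-local bound is applied to \<open>z\<close> and to \<open>\<lambda>v. sqrt (1 - 2 / c v) * z v\<close>; for an edge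
  of clique number \<open>k\<close> the two coefficients add up to at least
  \<open>k / (k - 1) + (k - 2) / (k - 1) = 2\<close>.
\<close>

lemma vertex_local_edge_sum_bound:
  fixes R :: "'v::finite \<Rightarrow> 'v \<Rightarrow> bool" and z :: "'v \<Rightarrow> real" and c :: "'v \<Rightarrow> nat"
  assumes R: "symp R" "irreflp R"
    and nonneg: "\<And>v. z v \<ge> 0"
    and c2: "\<And>v. c v \<ge> 2"
    and c: "\<And>S v. clique R S \<Longrightarrow> v \<in> S \<Longrightarrow> card S \<le> c v"
  shows "2 * (\<Sum>u\<in>UNIV. \<Sum>v\<in>UNIV. if R u v then z u * z v else 0)
    \<le> (\<Sum>v\<in>UNIV. z v)\<^sup>2 + (\<Sum>v\<in>UNIV. sqrt (1 - 2 / c v) * z v)\<^sup>2"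
proof -
  define k where "k u v = real (edge_clique_number R u v)" for u v
  define t where "t v = sqrt (1 - 2 / c v) * z v" for v
  have p0: "1 - 2 / real (c v) \<ge> 0" for v
    using c2[of v] by simp
  have t0: "t v \<ge> 0" for v
    using p0 nonneg by (simp add: t_def)
  have edge: "2 * (z u * z v) \<le> k u v / (k u v - 1) * (z u * z v) + k u v / (k u v - 1) * (t u * t v)"
    if "R u v" for u v
  proof -
    have k2: "k u v \<ge> 2"
      using edge_clique_number_ge_2[OF R that] by (simp add: k_def)
    define q where "q = 1 - 2 / k u v"
    have q0: "q \<ge> 0" using k2 by (simp add: q_def)
    \<comment> \<open>A largest clique through the edge contains both endpoints, so both vertex
      values \<open>c x\<close> are at least \<open>k u v\<close>.\<close>
    have qle: "q \<le> 1 - 2 / real (c x)" if "x \<in> {u, v}" for x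
    proof -
      have "k u v \<le> real (c x)"
        using edge_clique_number_attained[OF R(1) \<open>R u v\<close>] c that
        by (metis k_def of_nat_mono insert_iff singletonD)
      then show ?thesis using k2 by (simp add: q_def frac_le)
    qed
    have "q = sqrt q * sqrt q" using q0 by simp
    also have "\<dots> \<le> sqrt (1 - 2 / real (c u)) * sqrt (1 - 2 / real (c v))"
      using qle q0 p0 by (intro mult_mono) auto
    finally have "q * (z u * z v) \<le> sqrt (1 - 2 / real (c u)) * sqrt (1 - 2 / real (c v)) * (z u * z v)"
      by (rule mult_right_mono) (simp add: nonneg)
    then have "q * (z u * z v) \<le> t u * t v" by (simp add: t_def mult_ac)
    then have "k u v / (k u v - 1) * (q * (z u * z v)) \<le> k u v / (k u v - 1) * (t u * t v)"
      using k2 by (intro mult_left_mono) auto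
    moreover have "k u v / (k u v - 1) + k u v / (k u v - 1) * q = 2"
    proof -
      have "k u v * q = k u v - 2" using k2 by (simp add: q_def right_diff_distrib)
      then have "k u v / (k u v - 1) + k u v / (k u v - 1) * q = (k u v + (k u v - 2)) / (k u v - 1)"
        by (simp only: add_divide_distrib times_divide_eq_left)
      also have "\<dots> = 2" using k2 by (simp add: field_simps)
      finally show ?thesis .
    qed
    then have "k u v / (k u v - 1) * (z u * z v) + k u v / (k u v - 1) * (q * (z u * z v)) = 2 * (z u * z v)"
      by (metis distrib_right mult.assoc)
    ultimately show ?thesis by linarith
  qed
  have "2 * (\<Sum>u\<in>UNIV. \<Sum>v\<in>UNIV. if R u v then z u * z v else 0) =
      (\<Sum>u\<in>UNIV. \<Sum>v\<in>UNIV. if R u v then 2 * (z u * z v) else 0)"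
    by (simp add: sum_distrib_left if_distrib cong: if_cong)
  also have "\<dots> \<le> (\<Sum>u\<in>UNIV. \<Sum>v\<in>UNIV. (if R u v then k u v / (k u v - 1) * (z u * z v) else 0) +
      (if R u v then k u v / (k u v - 1) * (t u * t v) else 0))"
    by (intro sum_mono) (use edge in auto)
  also have "\<dots> \<le> (\<Sum>v\<in>UNIV. z v)\<^sup>2 + (\<Sum>v\<in>UNIV. t v)\<^sup>2"
    unfolding sum.distrib k_def
    by (intro add_mono edge_local_Motzkin_Straus R nonneg t0)
  finally show ?thesis by (simp add: t_def)
qed

section \<open>Balance and switching\<close>

text \<open>Each vertex of a cycle lies on exactly two of its edges, so every factor
  \<open>s v\<close> occurs squared in the sign of the cycle.\<close>

lemma balanced_if_switchable:
  assumes s: "\<And>v. s v = 1 \<or> s v = (-1::real)"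
    and switch: "\<And>u v. {u, v} \<in> E \<Longrightarrow> \<sigma> {u, v} = s u * s v"
  shows "balanced E \<sigma>"
  unfolding balanced_def
proof (intro allI impI)
  fix vs assume cyc: "is_cycle E vs"
  define n where "n = length vs"
  have n: "n \<ge> 3" using cyc by (simp add: is_cycle_def n_def)
  \<comment> \<open>The cyclic shift permutes positions, which identifies the product over second
    endpoints with the one over first endpoints.\<close>
  have bij: "bij_betw (\<lambda>i. Suc i mod n) {..<n} {..<n}"
  proof -
    have "inj_on (\<lambda>i. Suc i mod n) {..<n}"
      by (rule inj_onI) (auto simp: mod_Suc split: if_splits)
    moreover have "(\<lambda>i. Suc i mod n) ` {..<n} \<subseteq> {..<n}" using n by auto
    ultimately show ?thesis
      by (simp add: bij_betw_def endo_inj_surj)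
  qed
  have "cycle_sign \<sigma> vs = (\<Prod>i<n. s (vs ! i) * s (vs ! (Suc i mod n)))"
    unfolding cycle_sign_def n_def[symmetric]
    by (rule prod.cong) (use cyc switch in \<open>auto simp: is_cycle_def cycle_edge_def n_def\<close>)
  also have "\<dots> = (\<Prod>i<n. s (vs ! i)) * (\<Prod>i<n. s (vs ! (Suc i mod n)))"
    by (rule prod.distrib)
  also have "(\<Prod>i<n. s (vs ! (Suc i mod n))) = (\<Prod>i<n. s (vs ! i))"
    by (rule prod.reindex_bij_betw[OF bij])
  also have "(\<Prod>i<n. s (vs ! i)) * (\<Prod>i<n. s (vs ! i)) = (\<Prod>i<n. s (vs ! i) * s (vs ! i))"
    by (rule prod.distrib[symmetric])
  also have "\<dots> = 1"
    by (rule prod.neutral) (use s in \<open>metis mult_1 square_eq_1_iff\<close>)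
  finally show "cycle_sign \<sigma> vs = 1" .
qed

text \<open>The relation consists of the edges that become positive after switching by
  \<open>s\<close>; its cliques thereby become candidates for \<open>c_b\<close>.\<close>

lemma balanced_complete_if_clique:
  assumes "simple_graph E"
    and s: "\<And>v. s v = 1 \<or> s v = (-1::real)"
    and S: "clique (\<lambda>u v. {u, v} \<in> E \<and> \<sigma> {u, v} = s u * s v) S"
  shows "balanced_complete E \<sigma> S"
  unfolding balanced_complete_def
proof
  show "balanced (induced_edges E S) \<sigma>"
  proof (rule balanced_if_switchable[where s = s, OF s])
    fix u v assume uv: "{u, v} \<in> induced_edges E S"
    \<comment> \<open>The clique condition speaks of distinct vertices only, so loops are ruled out
      first.\<close>
    then have "u \<noteq> v"
      using assms(1) by (force simp: induced_edges_def simple_graph_def)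
    then show "\<sigma> {u, v} = s u * s v"
      using uv S by (auto simp: induced_edges_def clique_def)
  qed
qed (use S in \<open>auto simp: clique_def\<close>)

lemma c_b_ge: "balanced_complete E \<sigma> S \<Longrightarrow> v \<in> S \<Longrightarrow> card S \<le> c_b E \<sigma> v"
  unfolding c_b_def by (rule Max_ge) auto

lemma c_b_ge_2:
  assumes "signed_graph E \<sigma>" and e: "{u, v} \<in> E"
  shows "c_b E \<sigma> u \<ge> 2"
proof -
  have sg: "simple_graph E" and \<sigma>: "\<sigma> {u, v} = 1 \<or> \<sigma> {u, v} = -1"
    using assms by (auto simp: signed_graph_def)
  then have "u \<noteq> v" using e by (force simp: simple_graph_def)
  \<comment> \<open>The switching function carries the sign of the edge at \<open>u\<close> and 1
    elsewhere, so its product over the edge is that sign.\<close>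
  moreover have "balanced_complete E \<sigma> {u, v}"
    by (rule balanced_complete_if_clique[OF sg, where s = "\<lambda>x. if x = u then \<sigma> {u, v} else 1"])
      (use \<sigma> e \<open>u \<noteq> v\<close> in \<open>auto simp: clique_def insert_commute\<close>)
  ultimately show ?thesis using c_b_ge[of E \<sigma> "{u, v}" u] by simp
qed

section \<open>The quadratic form of \<open>Q_matrix\<close>\<close>

lemma transpose_Q_matrix: "transpose (Q_matrix E \<sigma> w) = Q_matrix E \<sigma> w"
  by (simp add: transpose_def Q_matrix_def D_matrix_def W_matrix_def vec_eq_iff
      insert_commute mult.commute)

text \<open>The diagonal is spread over ordered pairs so that it can be compared with the other sums
  pair by pair; the share \<open>w u * (x $ v)\<^sup>2\<close> is not symmetric in \<open>u\<close>
  and \<open>v\<close>.\<close>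

lemma Q_matrix_quadratic_form:
  "x \<bullet> (Q_matrix E \<sigma> w *v x) =
    (\<Sum>u\<in>UNIV. \<Sum>v\<in>UNIV. if {u, v} \<in> E
      then w u * (x $ v)\<^sup>2 + \<sigma> {u, v} * sqrt (w u * w v) * (x $ u * x $ v) else 0)"
proof -
  have "x \<bullet> (D_matrix E w *v x) = (\<Sum>v\<in>UNIV. (\<Sum>u | {u, v} \<in> E. w u) * (x $ v)\<^sup>2)"
    by (simp add: quadratic_form_sum D_matrix_def power2_eq_square if_distrib[of "\<lambda>a. a * _"]
        cong: if_cong)
  also have "\<dots> = (\<Sum>v\<in>UNIV. \<Sum>u\<in>UNIV. if {u, v} \<in> E then w u * (x $ v)\<^sup>2 else 0)"
    by (simp add: sum_distrib_right sum.If_cases)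
  also have "\<dots> = (\<Sum>u\<in>UNIV. \<Sum>v\<in>UNIV. if {u, v} \<in> E then w u * (x $ v)\<^sup>2 else 0)"
    by (rule sum.swap)
  finally have D: "x \<bullet> (D_matrix E w *v x) = \<dots>" .
  have W: "x \<bullet> (W_matrix E \<sigma> w *v x) = (\<Sum>u\<in>UNIV. \<Sum>v\<in>UNIV. if {u, v} \<in> E
      then \<sigma> {u, v} * sqrt (w u * w v) * (x $ u * x $ v) else 0)"
    unfolding quadratic_form_sum by (intro sum.cong) (auto simp: W_matrix_def)
  show ?thesis
    unfolding Q_matrix_def matrix_vector_mult_add_rdistrib inner_add_right D W sum.distrib[symmetric]
    by (intro sum.cong) auto
qed

text \<open>Both sides are compared on each pair in both orders. On an edge they agree, since the
  switched sign is 1 on a positive and -1 on a negative edge; elsewhere AM-GM applies.\<close>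

lemma Q_matrix_quadratic_form_le:
  fixes x :: "real^'v::finite"
  assumes \<sigma>: "signed_graph E \<sigma>" and w: "\<And>v. w v > 0"
  defines "s \<equiv> \<lambda>v. if x $ v < 0 then - 1 else (1::real)"
    and "z \<equiv> \<lambda>v. sqrt (w v) * \<bar>x $ v\<bar>"
  shows "x \<bullet> (Q_matrix E \<sigma> w *v x) \<le> (\<Sum>v\<in>UNIV. w v) * (x \<bullet> x)
    + 2 * (\<Sum>u\<in>UNIV. \<Sum>v\<in>UNIV. if {u, v} \<in> E \<and> \<sigma> {u, v} = s u * s v then z u * z v else 0)
    - (\<Sum>v\<in>UNIV. z v)\<^sup>2"
proof -
  define P where "P u v = (if {u, v} \<in> E \<and> \<sigma> {u, v} = s u * s v then z u * z v else 0)" for u v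
  \<comment> \<open>The deficit, right side minus left side, of one ordered pair. It may be negative
    alone; only \<open>h u v + h v u\<close> is shown nonnegative, which suffices for the double
    sum.\<close>
  define h where "h u v = w u * (x $ v)\<^sup>2 + 2 * P u v - z u * z v -
    (if {u, v} \<in> E then w u * (x $ v)\<^sup>2 + \<sigma> {u, v} * sqrt (w u * w v) * (x $ u * x $ v) else 0)" for u v
  have sx: "sqrt (w v) * x $ v = s v * z v" for v
    by (simp add: s_def z_def)
  have h: "h u v + h v u \<ge> 0" for u v
  proof (cases "{u, v} \<in> E")
    case True
    have "\<sigma> {u, v} = 1 \<or> \<sigma> {u, v} = -1"
      using \<sigma> True by (auto simp: signed_graph_def)
    moreover have "sqrt (w u * w v) * (x $ u * x $ v) = (s u * s v) * (z u * z v)"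
      using sx[of u] sx[of v] by (simp add: real_sqrt_mult algebra_simps)
    moreover have "s u * s v = 1 \<or> s u * s v = -1"
      by (simp add: s_def)
    ultimately have "\<sigma> {u, v} * sqrt (w u * w v) * (x $ u * x $ v) = 2 * P u v - z u * z v"
      using True by (auto simp: P_def mult.assoc[symmetric])
    moreover have "P v u = P u v" by (simp add: P_def insert_commute mult.commute)
    ultimately show ?thesis
      using True by (simp add: h_def insert_commute mult_ac)
  next
    case False
    \<comment> \<open>The weights are crossed so that the mixed term is
      \<open>2 * (z u * z v)\<close> and the squares are the two diagonal shares.\<close>
    have "(sqrt (w u) * \<bar>x $ v\<bar> - sqrt (w v) * \<bar>x $ u\<bar>)\<^sup>2 \<ge> 0" by simp
    then have "2 * (z u * z v) \<le> w u * (x $ v)\<^sup>2 + w v * (x $ u)\<^sup>2"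
      using w[of u] w[of v]
      by (simp add: z_def power2_diff power_mult_distrib algebra_simps)
    then show ?thesis using False by (simp add: h_def P_def insert_commute mult_ac)
  qed
  have "2 * (\<Sum>u\<in>UNIV. \<Sum>v\<in>UNIV. h u v) = (\<Sum>u\<in>UNIV. \<Sum>v\<in>UNIV. h u v) + (\<Sum>u\<in>UNIV. \<Sum>v\<in>UNIV. h v u)"
    using sum.swap[of h UNIV UNIV] by simp
  also have "\<dots> = (\<Sum>u\<in>UNIV. \<Sum>v\<in>UNIV. h u v + h v u)"
    by (simp add: sum.distrib)
  also have "\<dots> \<ge> 0" by (intro sum_nonneg h)
  finally have "(\<Sum>u\<in>UNIV. \<Sum>v\<in>UNIV. h u v) \<ge> 0" by simp
  moreover have "(\<Sum>u\<in>UNIV. \<Sum>v\<in>UNIV. w u * (x $ v)\<^sup>2) = (\<Sum>v\<in>UNIV. w v) * (x \<bullet> x)"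
    by (simp add: inner_vec_def sum_product power2_eq_square)
  moreover have "(\<Sum>u\<in>UNIV. \<Sum>v\<in>UNIV. z u * z v) = (\<Sum>v\<in>UNIV. z v)\<^sup>2"
    by (simp add: sum_product power2_eq_square)
  ultimately show ?thesis
    unfolding Q_matrix_quadratic_form
    by (simp add: h_def sum.distrib sum_subtractf sum_distrib_left P_def)
qed

text \<open>The square of the sum of \<open>z v\<close> cancels between the two preceding bounds,
  and Cauchy-Schwarz handles the rest. The assumption \<open>c2\<close> makes the numbers
  \<open>p v\<close> nonnegative, so that their square roots can serve as weights.\<close>

lemma Q_matrix_quadratic_form_bound:
  fixes x :: "real^'v::finite"
  assumes \<sigma>: "signed_graph E \<sigma>" and w: "\<And>v. w v > 0"
    and c2: "\<And>v. c_b E \<sigma> v \<ge> 2"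
  shows "x \<bullet> (Q_matrix E \<sigma> w *v x) \<le> 2 * (\<Sum>v\<in>UNIV. (1 - 1 / real (c_b E \<sigma> v)) * w v) * (x \<bullet> x)"
proof -
  define s where "s v = (if x $ v < 0 then - 1 else (1::real))" for v
  define z where "z v = sqrt (w v) * \<bar>x $ v\<bar>" for v
  define p where "p v = 1 - 2 / real (c_b E \<sigma> v)" for v
  define R where "R u v \<longleftrightarrow> {u, v} \<in> E \<and> \<sigma> {u, v} = s u * s v" for u v
  have sg: "simple_graph E" using \<sigma> by (simp add: signed_graph_def)
  have p0: "p v \<ge> 0" for v using c2[of v] by (simp add: p_def)
  have "2 * (\<Sum>u\<in>UNIV. \<Sum>v\<in>UNIV. if R u v then z u * z v else 0)
      \<le> (\<Sum>v\<in>UNIV. z v)\<^sup>2 + (\<Sum>v\<in>UNIV. sqrt (p v) * z v)\<^sup>2"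
    unfolding p_def
  proof (rule vertex_local_edge_sum_bound)
    show "symp R" by (auto simp: symp_def R_def insert_commute mult.commute)
    show "irreflp R" using sg by (force simp: irreflp_def R_def simple_graph_def)
    show "z v \<ge> 0" for v using w[of v] by (simp add: z_def)
    show "c_b E \<sigma> v \<ge> 2" for v by (rule c2)
    show "card S \<le> c_b E \<sigma> v" if "clique R S" "v \<in> S" for S v
    proof (rule c_b_ge[OF _ \<open>v \<in> S\<close>], rule balanced_complete_if_clique[OF sg])
      show "s v = 1 \<or> s v = -1" for v by (simp add: s_def)
      show "clique (\<lambda>u v. {u, v} \<in> E \<and> \<sigma> {u, v} = s u * s v) S"
        using that by (simp add: clique_def R_def)
    qed
  qed
  moreover have "(\<Sum>v\<in>UNIV. sqrt (p v) * z v)\<^sup>2 \<le> (\<Sum>v\<in>UNIV. p v * w v) * (x \<bullet> x)"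
  proof -
    \<comment> \<open>The factors come from
      \<open>sqrt (p v) * z v = sqrt (p v * w v) * \<bar>x $ v\<bar>\<close>.\<close>
    have "(\<Sum>v\<in>UNIV. sqrt (p v * w v) * \<bar>x $ v\<bar>)\<^sup>2
        \<le> (\<Sum>v\<in>UNIV. (sqrt (p v * w v))\<^sup>2) * (\<Sum>v\<in>UNIV. \<bar>x $ v\<bar>\<^sup>2)"
      by (rule Cauchy_Schwarz_ineq_sum)
    moreover have "(sqrt (p v * w v))\<^sup>2 = p v * w v" for v
      using p0[of v] w[of v] by simp
    ultimately show ?thesis
      by (simp add: z_def real_sqrt_mult inner_vec_def power2_eq_square mult.assoc)
  qed
  moreover have "x \<bullet> (Q_matrix E \<sigma> w *v x) \<le> (\<Sum>v\<in>UNIV. w v) * (x \<bullet> x)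
    + 2 * (\<Sum>u\<in>UNIV. \<Sum>v\<in>UNIV. if R u v then z u * z v else 0) - (\<Sum>v\<in>UNIV. z v)\<^sup>2"
    unfolding R_def s_def z_def by (rule Q_matrix_quadratic_form_le[OF \<sigma> w])
  ultimately have "x \<bullet> (Q_matrix E \<sigma> w *v x) \<le> ((\<Sum>v\<in>UNIV. w v) + (\<Sum>v\<in>UNIV. p v * w v)) * (x \<bullet> x)"
    by (simp add: distrib_right)
  also have "(\<Sum>v\<in>UNIV. w v) + (\<Sum>v\<in>UNIV. p v * w v) =
      2 * (\<Sum>v\<in>UNIV. (1 - 1 / real (c_b E \<sigma> v)) * w v)"
    by (simp add: p_def sum_distrib_left flip: sum.distrib) (simp add: algebra_simps)
  finally show ?thesis .
qed

theorem theorem4p1: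
  fixes E :: "'v::finite set set"
    and \<sigma> :: "'v set \<Rightarrow> real"
    and w :: "'v \<Rightarrow> real"
  assumes "signed_graph E \<sigma>"
    and "graph_connected E"
    and "\<And>v. w v > 0"
  shows "lambda1 (Q_matrix E \<sigma> w) \<le> 2 * (\<Sum>v\<in>UNIV. (1 - 1 / real (c_b E \<sigma> v)) * w v)"
    (is "?l \<le> ?B")
proof -
  obtain x where x: "x \<noteq> 0" "Q_matrix E \<sigma> w *v x = ?l *\<^sub>R x"
    using lambda1_in_eigenvalues[OF transpose_Q_matrix, of E \<sigma> w] by (auto simp: eigenvalues_def)
  have "x \<bullet> (Q_matrix E \<sigma> w *v x) \<le> ?B * (x \<bullet> x)"
  proof (cases "E = {}")
    \<comment> \<open>Without edges every \<open>c_b E \<sigma> v\<close> is 1 and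
      \<open>1 - 2 / c_b\<close> is negative, so this case is separate; the form is zero and the
      bound is nonnegative.\<close>
    case True
    have "c_b E \<sigma> v \<ge> 1" for v
      using c_b_ge[of E \<sigma> "{v}" v] True
      by (fastforce simp: balanced_complete_def balanced_def induced_edges_def is_cycle_def)
    then have "?B \<ge> 0"
      using assms(3) by (intro mult_nonneg_nonneg sum_nonneg) (auto simp: less_imp_le Suc_le_eq divide_le_eq_1)
    then show ?thesis
      using True by (simp add: Q_matrix_quadratic_form)
  next
    case False
    \<comment> \<open>Connectedness enters here: a path from \<open>u\<close> to an endpoint
      \<open>a\<close> of some edge either has a first step, giving a neighbour, or is trivial, and
      then \<open>b\<close> is one.\<close>
    have "\<exists>v. {u, v} \<in> E" for u
    proof -
      obtain a b where ab: "{a, b} \<in> E"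
        using False assms(1) by (metis all_not_in_conv card_2_iff signed_graph_def simple_graph_def)
      have "(u, a) \<in> {(x, y). {x, y} \<in> E}\<^sup>*"
        using assms(2) by (simp add: graph_connected_def)
      then show ?thesis
        using ab by (cases rule: converse_rtranclE) auto
    qed
    then have "c_b E \<sigma> u \<ge> 2" for u
      using c_b_ge_2[OF assms(1)] by metis
    then show ?thesis
      by (intro Q_matrix_quadratic_form_bound assms)
  qed
  then show ?thesis using x by simp
qed

end
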